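(* Let $q$ be a prime power and let $\mathcal{S}$ be a $(4,2)$-MSR subspace family over $\mathbb{F}_q$, that is, a set of $2$-dimensional subspaces of $\mathbb{F}_q^4$ such that for every $S\in\mathcal{S}$ there exists $g\in\mathrm{PGL}(4,q)$ with $S\cap S^{g}=\{0\}$ and $T^{g}=T$ for all $T\in\mathcal{S}\setminus\{S\}$. Then $|\mathcal{S}|\le 6$. Moreover, if $|\mathcal{S}|=6$, then $q\ge 3$ and $\mathcal{S}$ is isomorphic to the family consisting of the six subspaces $$\langle e_1,e_3\rangle,\quad \langle e_2,e_4\rangle,\quad \langle e_1+e_2,\,e_3+e_4\rangle,\quad \langle e_1,e_2\rangle,\quad \langle e_3,e_4\rangle,\quad \langle e_1+e_3,\,e_2+e_4\rangle .$$
   Context: $\mathbb{F}_q$ is the finite field with $q$ elements; $e_i$ denotes the $i$-th vector of the canonical basis of $\mathbb{F}_q^4$. $\mathrm{PGL}(4,q)=\mathrm{GL}(4,q)/\mathbb{F}_q^*$ acts on the subspaces of $\mathbb{F}_q^4$, and $S^g$ denotes the image of the subspace $S$ under $g$. Two families of subspaces of $\mathbb{F}_q^4$ are isomorphic if some element of $\mathrm{PGL}(4,q)$ maps one family (as a set) onto the other. *)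

theory Defs
  imports "HOL-Analysis.Cartesian_Space" "HOL-Algebra.Coset"
begin

definition GL :: "('a::field ^ 'n ^ 'n) monoid" where
  "GL = \<lparr>carrier = {A. invertible A}, monoid.mult = (**), one = mat 1\<rparr>"

definition scalar_matrices :: "('a::field ^ 'n ^ 'n) set" where
  "scalar_matrices = {mat c | c. c \<noteq> 0}"

definition PGL :: "('a::field ^ 'n ^ 'n) set monoid" where
  "PGL = GL Mod scalar_matrices"

lemma group_GL: "group (GL :: ('a::field ^ 'n ^ 'n) monoid)"
proof (rule groupI)
  fix A B C :: "'a ^ 'n ^ 'n"
  show "A \<otimes>\<^bsub>GL\<^esub> B \<in> carrier GL" if "A \<in> carrier GL" "B \<in> carrier GL"
    using that by (simp add: GL_def invertible_mult)
  show "A \<otimes>\<^bsub>GL\<^esub> B \<otimes>\<^bsub>GL\<^esub> C = A \<otimes>\<^bsub>GL\<^esub> (B \<otimes>\<^bsub>GL\<^esub> C)"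
    by (simp add: GL_def matrix_mul_assoc)
  show "\<one>\<^bsub>GL\<^esub> \<otimes>\<^bsub>GL\<^esub> A = A"
    by (simp add: GL_def)
  show "\<exists>B\<in>carrier GL. B \<otimes>\<^bsub>GL\<^esub> A = \<one>\<^bsub>GL\<^esub>" if "A \<in> carrier GL"
  proof -
    obtain B where "A ** B = mat 1" "B ** A = mat 1"
      using \<open>A \<in> carrier GL\<close> by (auto simp: GL_def invertible_def)
    then show ?thesis
      by (intro bexI[of _ B]) (simp_all only: GL_def monoid.simps partial_object.simps mem_Collect_eq invertible_def, blast)
  qed
next
  show "\<one>\<^bsub>GL\<^esub> \<in> carrier (GL :: ('a ^ 'n ^ 'n) monoid)"
    by (auto simp: GL_def invertible_def intro: exI[of _ "mat 1"])
qed

lemma mat_mult_entry: "(mat c ** A) $ i $ j = c * A $ i $ j" for A :: "'a::field ^ 'm ^ 'n"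
proof -
  have "(mat c ** A) $ i $ j = (\<Sum>k\<in>UNIV. if i = k then c * A $ k $ j else 0)"
    unfolding matrix_matrix_mult_def mat_def vec_lambda_beta by (rule sum.cong) simp_all
  then show ?thesis by simp
qed

lemma mult_mat_entry: "(A ** mat c) $ i $ j = c * A $ i $ j" for A :: "'a::field ^ 'n ^ 'm"
proof -
  have "(A ** mat c) $ i $ j = (\<Sum>k\<in>UNIV. if k = j then c * A $ i $ k else 0)"
    unfolding matrix_matrix_mult_def mat_def vec_lambda_beta by (rule sum.cong) simp_all
  then show ?thesis by simp
qed

lemma mat_mul_commute: "mat c ** A = A ** mat (c::'a::field)"
  by (simp add: vec_eq_iff mat_mult_entry mult_mat_entry)

lemma mat_mul_mat: "mat c ** mat d = (mat (c * d) :: 'a::field ^ 'n ^ 'n)"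
  by (simp add: vec_eq_iff mat_mult_entry) (simp add: mat_def)

lemma mat_mult_vec: "mat c *v v = c *s (v :: 'a::field ^ 'n)"
proof -
  have "(mat c *v v) $ i = (\<Sum>k\<in>UNIV. if i = k then c * v $ k else 0)" for i
    unfolding matrix_vector_mult_def mat_def vec_lambda_beta by (rule sum.cong) simp_all
  then show ?thesis by (simp add: vec_eq_iff)
qed

lemma invertible_mat: "c \<noteq> 0 \<Longrightarrow> invertible (mat c :: 'a::field ^ 'n ^ 'n)"
  unfolding invertible_def by (rule exI[of _ "mat (inverse c)"]) (simp add: mat_mul_mat)

lemma scalar_matrices_normal: "scalar_matrices \<lhd> (GL :: ('a::field ^ 'n ^ 'n) monoid)"
proof -
  interpret group "GL :: ('a ^ 'n ^ 'n) monoid" by (rule group_GL)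
  have inv: "inv\<^bsub>GL\<^esub> (mat c) = (mat (inverse c) :: 'a ^ 'n ^ 'n)" if "c \<noteq> 0" for c
    using that by (intro inv_equality) (simp_all add: GL_def mat_mul_mat invertible_mat)
  have sub: "subgroup scalar_matrices (GL :: ('a ^ 'n ^ 'n) monoid)"
  proof (rule subgroupI)
    show "scalar_matrices \<subseteq> carrier (GL :: ('a ^ 'n ^ 'n) monoid)"
      by (auto simp: scalar_matrices_def GL_def invertible_mat)
    show "scalar_matrices \<noteq> ({} :: ('a ^ 'n ^ 'n) set)"
      unfolding scalar_matrices_def using one_neq_zero by blast
  next
    fix A :: "'a ^ 'n ^ 'n" assume "A \<in> scalar_matrices"
    then obtain c where "c \<noteq> 0" "A = mat c" unfolding scalar_matrices_def by blast
    then have "inverse c \<noteq> 0" "inv\<^bsub>GL\<^esub> A = mat (inverse c)" by (simp_all add: inv)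
    then show "inv\<^bsub>GL\<^esub> A \<in> scalar_matrices" unfolding scalar_matrices_def by blast
  next
    fix A B :: "'a ^ 'n ^ 'n" assume "A \<in> scalar_matrices" "B \<in> scalar_matrices"
    then obtain c d where "c \<noteq> 0" "A = mat c" "d \<noteq> 0" "B = mat d"
      unfolding scalar_matrices_def by blast
    then have "c * d \<noteq> 0" "A \<otimes>\<^bsub>GL\<^esub> B = mat (c * d)" by (simp_all add: GL_def mat_mul_mat)
    then show "A \<otimes>\<^bsub>GL\<^esub> B \<in> scalar_matrices" unfolding scalar_matrices_def by blast
  qed
  have "scalar_matrices #>\<^bsub>GL\<^esub> A = A <#\<^bsub>GL\<^esub> scalar_matrices" for A :: "'a ^ 'n ^ 'n"
  proof -
    have "C \<otimes>\<^bsub>GL\<^esub> A = A \<otimes>\<^bsub>GL\<^esub> C" if C: "C \<in> scalar_matrices" for C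
    proof -
      obtain c where "C = mat c" using C unfolding scalar_matrices_def by blast
      then show ?thesis by (simp add: GL_def mat_mul_commute[of c A])
    qed
    then show ?thesis unfolding r_coset_def l_coset_def by (simp cong: SUP_cong)
  qed
  then show ?thesis by (intro normalI[OF sub]) blast
qed

text \<open>An element of \<^const>\<open>PGL\<close> is a coset of matrices. On a subspace all its members have the
  same image, which is therefore also the union of these images; see \<open>pgl_image_coset\<close>.\<close>

definition pgl_image :: "('a::field ^ 'n ^ 'n) set \<Rightarrow> ('a ^ 'n) set \<Rightarrow> ('a ^ 'n) set" where
  "pgl_image g S = (\<Union>A\<in>g. (*v) A ` S)"

lemma pgl_image_coset:
  assumes "vec.subspace (S :: ('a::field ^ 'n) set)"
  shows "pgl_image (scalar_matrices #>\<^bsub>GL\<^esub> A) S = (*v) A ` S"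
proof -
  have eq: "(mat c ** A) *v v = A *v (c *s v)" for c v
  proof -
    have "(mat c ** A) *v v = (A ** mat c) *v v"
      by (simp only: mat_mul_commute[of c A])
    also have "\<dots> = A *v (mat c *v v)"
      by (simp only: matrix_vector_mul_assoc)
    finally show ?thesis
      by (simp only: mat_mult_vec)
  qed
  have eq': "(*v) (mat c ** A) = (\<lambda>v. A *v (c *s v))" for c
    by (rule ext) (rule eq)
  have coset: "scalar_matrices #>\<^bsub>GL\<^esub> A = (\<lambda>c. mat c ** A) ` {c. c \<noteq> 0}"
    unfolding r_coset_def scalar_matrices_def GL_def monoid.simps by blast
  have "pgl_image (scalar_matrices #>\<^bsub>GL\<^esub> A) S = (\<Union>c\<in>{c. c \<noteq> 0}. (\<lambda>v. A *v (c *s v)) ` S)"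
    unfolding pgl_image_def coset by (simp only: image_image eq')
  also have "\<dots> = (*v) A ` S"
  proof
    show "(\<Union>c\<in>{c. c \<noteq> 0}. (\<lambda>v. A *v (c *s v)) ` S) \<subseteq> (*v) A ` S"
      using vec.subspace_scale[OF assms] by blast
    have "A *v v \<in> (\<lambda>v. A *v (1 *s v)) ` S" if "v \<in> S" for v
      using that by (simp only: vector_smult_lid image_eqI)
    then show "(*v) A ` S \<subseteq> (\<Union>c\<in>{c. c \<noteq> 0}. (\<lambda>v. A *v (c *s v)) ` S)"
      using one_neq_zero by blast
  qed
  finally show ?thesis .
qed

definition msr_family_4_2 :: "('a::field ^ 4) set set \<Rightarrow> bool" where
  "msr_family_4_2 \<S> \<longleftrightarrow>
     (\<forall>S\<in>\<S>. vec.subspace S \<and> vec.dim S = 2) \<and>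
     (\<forall>S\<in>\<S>. \<exists>g\<in>carrier PGL. S \<inter> pgl_image g S = {0} \<and> (\<forall>T\<in>\<S> - {S}. pgl_image g T = T))"

definition isomorphic_families ::
  "('a::field ^ 'n) set set \<Rightarrow> ('a ^ 'n) set set \<Rightarrow> bool" where
  "isomorphic_families \<S> \<T> \<longleftrightarrow> (\<exists>g\<in>carrier PGL. pgl_image g ` \<S> = \<T>)"

text \<open>In the index type \<open>4\<close> the numeral \<open>4\<close> equals \<open>0\<close>, so the four indices
  \<open>1, 2, 3, 4\<close> are distinct and exhaust the type.\<close>

definition six_subspaces :: "('a::field ^ 4) set set" where
  "six_subspaces = (let e = (\<lambda>i. axis i 1) in
     {vec.span {e 1, e 3}, vec.span {e 2, e 4}, vec.span {e 1 + e 2, e 3 + e 4},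
      vec.span {e 1, e 2}, vec.span {e 3, e 4}, vec.span {e 1 + e 3, e 2 + e 4}})"

end

theory Submission
  imports Defs
begin

text \<open>The members of the family are lines of projective three-space. For each of them there is a matrix
  that fixes all the others and moves it to a skew line. Three members cannot meet pairwise: they would be
  concurrent or coplanar, and the matrix moving one of them would fix the common point or plane
  (\<open>no_three_pairwise_meeting\<close>). By Ramsey's theorem six members contain three pairwise skew
  ones, \<open>U\<close>, \<open>V\<close> and \<open>W\<close>.

  In suitable coordinates the whole space is a direct sum of two copies of a vector plane, the lines \<open>U\<close> and \<open>V\<close> are
  the summands and \<open>W\<close> is the diagonal. A matrix fixing all three acts by one \<open>2 \<times> 2\<close> matrix on both
  copies. A fourth member \<open>L\<close> that is skew to \<open>V\<close> is the graph of some \<open>2 \<times> 2\<close> matrix, and it is fixed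
  only if the action commutes with that matrix. The graph of a scalar could not be moved while \<open>U\<close>, \<open>V\<close> and
  \<open>W\<close> are fixed, so the matrix is not a scalar, and its commutant is spanned by the identity and any
  nonscalar element (\<open>stabilizer_pencil\<close>). Consequently the matrices that move two further members
  both lie in this commutant and fix the same subspaces, which is absurd. So every other member meets \<open>V\<close>,
  and by symmetry \<open>U\<close> and \<open>W\<close> (\<open>fourth_line_meets\<close>).

  The other members are then pairwise skew, as two that met would form a triangle with \<open>U\<close>. If there were
  four of them, three would play the part of \<open>U\<close>, \<open>V\<close>, \<open>W\<close> and the fourth would have to meet these three.
  Hence there are at most six members in all, and exactly six form a grid of two triples of skew lines,
  which has a unique shape up to projectivities (\<open>grid_frame\<close>). Over the field with two elements, the
  matrix moving one line of the grid would fix two intersection points as vectors, and hence also their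
  sum, which lies on that line.\<close>

section \<open>Lines of projective three-space\<close>

definition line :: "('a::field ^ 4) set \<Rightarrow> bool" where
  "line S \<longleftrightarrow> vec.subspace S \<and> vec.dim S = 2"

abbreviation skew :: "('a::field ^ 4) set \<Rightarrow> ('a ^ 4) set \<Rightarrow> bool" where
  "skew S T \<equiv> S \<inter> T = {0}"

definition indep2 :: "'a::field ^ 'n \<Rightarrow> 'a ^ 'n \<Rightarrow> bool" where
  "indep2 x y \<longleftrightarrow> (\<forall>a b. a *s x + b *s y = 0 \<longrightarrow> a = 0 \<and> b = 0)"

lemma in_span_pair: "z \<in> vec.span {x, y} \<longleftrightarrow> (\<exists>a b. z = a *s x + b *s y)"
  for x y z :: "'a::field ^ 'n"
proof -
  have "z \<in> vec.span {x, y} \<longleftrightarrow> (\<exists>a b. z - a *s x - b *s y = 0)"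
    by (simp add: vec.span_breakdown_eq)
  also have "\<dots> \<longleftrightarrow> (\<exists>a b. z = a *s x + b *s y)"
    by (metis diff_diff_add eq_iff_diff_eq_0)
  finally show ?thesis .
qed

lemma indep2I:
  assumes "x \<noteq> 0" "\<And>c. y \<noteq> c *s x"
  shows "indep2 x y"
  unfolding indep2_def
proof (intro allI impI)
  fix a b assume ab: "a *s x + b *s y = 0"
  have "b = 0"
  proof (rule ccontr)
    assume "b \<noteq> 0"
    then have "y = (- a / b) *s x"
      using ab by (simp add: vec_eq_iff field_simps eq_neg_iff_add_eq_0)
    with assms(2) show False by blast
  qed
  with ab assms(1) show "a = 0 \<and> b = 0" by simp
qed

lemma line_span:
  assumes "line S" "x \<in> S" "y \<in> S" "indep2 x y"
  shows "S = vec.span {x, y}"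
proof -
  have sub: "vec.subspace S" and dim: "vec.dim S = 2"
    using assms(1) by (auto simp: line_def)
  have x: "x \<notin> vec.span {y}"
  proof
    assume "x \<in> vec.span {y}"
    then obtain k where "x = k *s y" by (auto simp: vec.span_singleton)
    then have "1 *s x + (- k) *s y = 0" by (simp add: vec_eq_iff)
    with assms(4) show False unfolding indep2_def by (metis one_neq_zero)
  qed
  have "y \<noteq> 0"
  proof
    assume "y = 0"
    then have "0 *s x + 1 *s y = 0" by simp
    with assms(4) show False unfolding indep2_def by (metis one_neq_zero)
  qed
  moreover have xy: "x \<noteq> y" using x vec.span_base[of y "{y}"] by auto
  ultimately have "vec.independent {x, y}"
    using x by (simp add: vec.independent_insert)
  with sub dim xy assms(2,3) show ?thesis
    by (intro antisym vec.card_ge_dim_independent vec.span_minimal) auto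
qed

lemma line_basis:
  assumes "line S"
  obtains x y where "indep2 x y" "S = vec.span {x, y}"
proof -
  obtain B where B: "B \<subseteq> S" "vec.independent B" "S \<subseteq> vec.span B" "card B = 2"
    using vec.basis_exists[of S] assms unfolding line_def by metis
  then obtain x y where xy: "B = {x, y}" "x \<noteq> y" by (auto simp: card_2_iff)
  have x: "x \<notin> vec.span {y}" and y: "y \<noteq> 0"
    using B(2) xy by (auto simp: vec.independent_insert)
  have "indep2 y x"
    using x y by (intro indep2I) (auto simp: vec.span_singleton)
  then show ?thesis using that line_span[OF assms, of y x] B(1) xy(1) by blast
qed

lemma line_nonzero:
  assumes "line S"
  obtains x where "x \<in> S" "x \<noteq> 0"
proof -
  obtain x y where xy: "indep2 x y" "S = vec.span {x, y}" by (rule line_basis[OF assms])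
  have "x \<noteq> 0"
  proof
    assume "x = 0"
    then have "1 *s x + 0 *s y = 0" by simp
    with xy(1) show False unfolding indep2_def by (metis one_neq_zero)
  qed
  with xy(2) show ?thesis by (intro that[of x]) (auto intro: vec.span_base)
qed

text \<open>Two skew lines span the whole space, by the dimension formula.\<close>

lemma skew_decompose:
  assumes "line S" "line T" "skew S T"
  obtains s t where "s \<in> S" "t \<in> T" "x = s + t"
proof -
  define H where "H = {s + t |s t. s \<in> S \<and> t \<in> T}"
  have sub: "vec.subspace H"
    unfolding H_def using vec.subspace_sums assms unfolding line_def by blast
  have "vec.dim (S \<inter> T) = 0" using assms(3) by simp
  then have "vec.dim H = 4"
    using vec.dim_sums_Int[of S T, folded H_def] assms unfolding line_def by linarith
  then have "vec.span H = UNIV"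
    using vec.dim_eq_full[of H] unfolding vec.dimension_def card_cart_basis by simp
  then have "x \<in> H" using sub by (simp add: vec.span_eq_iff[THEN iffD2])
  then show ?thesis using that unfolding H_def by blast
qed

text \<open>Distinct lines meet in at most a projective point.\<close>

lemma meet_multiple:
  assumes "line S" "line T" "S \<noteq> T" "x \<in> S" "x \<in> T" "x \<noteq> 0" "y \<in> S" "y \<in> T"
  shows "\<exists>c. y = c *s x"
proof -
  have "\<not> indep2 x y"
    using line_span[of S x y] line_span[of T x y] assms by blast
  then show ?thesis using indep2I[OF assms(6)] by blast
qed

lemma skew_sum_eq_0:
  assumes "vec.subspace T" "skew S T" "s \<in> S" "t \<in> T" "s + t = 0"
  shows "s = 0" "t = 0"
proof -
  have "s = - t" using assms(5) by (simp add: eq_neg_iff_add_eq_0)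
  then have "s \<in> T" using vec.subspace_neg[OF assms(1,4)] by simp
  then show "s = 0" using assms(2,3) by blast
  then show "t = 0" using assms(5) by simp
qed

lemma skew_sum_nonzero:
  assumes "vec.subspace T" "skew S T" "s \<in> S" "t \<in> T" "s \<noteq> 0"
  shows "s + t \<noteq> 0"
  using skew_sum_eq_0(1)[OF assms(1-4)] assms(5) by blast

lemma indep2_skew:
  assumes "vec.subspace S" "vec.subspace T" "skew S T" "x \<in> S" "y \<in> T" "x \<noteq> 0" "y \<noteq> 0"
  shows "indep2 x y"
  unfolding indep2_def
proof (intro allI impI)
  fix a b assume ab: "a *s x + b *s y = 0"
  have "a *s x \<in> S" "b *s y \<in> T" using assms vec.subspace_scale by blast+
  then show "a = 0 \<and> b = 0"
    using skew_sum_eq_0[OF assms(2,3) _ _ ab] assms(6,7) by simp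
qed

lemma line_span_skew:
  assumes "line L" "vec.subspace S" "vec.subspace T" "skew S T"
    "x \<in> L" "x \<in> S" "x \<noteq> 0" "y \<in> L" "y \<in> T" "y \<noteq> 0"
  shows "L = vec.span {x, y}"
  using line_span[OF assms(1,5,8)] indep2_skew[OF assms(2,3,4,6,9,7,10)] by blast

definition indep4 :: "'a::field ^ 'n \<Rightarrow> 'a ^ 'n \<Rightarrow> 'a ^ 'n \<Rightarrow> 'a ^ 'n \<Rightarrow> bool" where
  "indep4 x y z w \<longleftrightarrow> (\<forall>a b c d. a *s x + b *s y + c *s z + d *s w = 0 \<longrightarrow> a = 0 \<and> b = 0 \<and> c = 0 \<and> d = 0)"

lemma indep4_coefficients:
  assumes "indep4 x y z w"
    and "a *s x + b *s y + c *s z + d *s w = a' *s x + b' *s y + c' *s z + d' *s w"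
  shows "a = a'" "b = b'" "c = c'" "d = d'"
proof -
  have "(a - a') *s x + (b - b') *s y + (c - c') *s z + (d - d') *s w =
    (a *s x + b *s y + c *s z + d *s w) - (a' *s x + b' *s y + c' *s z + d' *s w)"
    by (simp add: vec_eq_iff algebra_simps)
  also have "\<dots> = 0" using assms(2) by simp
  finally have "a - a' = 0 \<and> b - b' = 0 \<and> c - c' = 0 \<and> d - d' = 0"
    using assms(1) unfolding indep4_def by blast
  then show "a = a'" "b = b'" "c = c'" "d = d'" by auto
qed

lemma indep4_skew:
  assumes "skew (vec.span {x, y}) (vec.span {z, w})" "indep2 x y" "indep2 z w"
  shows "indep4 x y z w"
  unfolding indep4_def
proof (intro allI impI)
  fix a b c d assume eq: "a *s x + b *s y + c *s z + d *s w = 0"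
  have span: "a *s x + b *s y \<in> vec.span {x, y}" "c *s z + d *s w \<in> vec.span {z, w}"
    by (auto simp: in_span_pair)
  have "(a *s x + b *s y) + (c *s z + d *s w) = 0" using eq by (simp add: add.assoc)
  from skew_sum_eq_0[OF vec.subspace_span assms(1) span this]
  have "a *s x + b *s y = 0" "c *s z + d *s w = 0" .
  then show "a = 0 \<and> b = 0 \<and> c = 0 \<and> d = 0"
    using assms(2,3) unfolding indep2_def by blast
qed

section \<open>Moving one line of a family\<close>

abbreviation stabilizes :: "'a::field ^ 'n ^ 'n \<Rightarrow> ('a ^ 'n) set \<Rightarrow> bool" where
  "stabilizes A S \<equiv> \<forall>x\<in>S. A *v x \<in> S"

lemma msr_line: "msr_family_4_2 F \<Longrightarrow> S \<in> F \<Longrightarrow> line S"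
  by (simp add: msr_family_4_2_def line_def)

text \<open>From here on matrices replace their cosets modulo the scalars, which have the same action on subspaces.\<close>

lemma msr_matrix:
  assumes "msr_family_4_2 F" "S \<in> F"
  obtains A where "invertible A" "skew S ((*v) A ` S)" "\<And>T. T \<in> F \<Longrightarrow> T \<noteq> S \<Longrightarrow> (*v) A ` T = T"
proof -
  have lines: "\<forall>S\<in>F. vec.subspace S \<and> vec.dim S = 2"
    and "\<forall>S\<in>F. \<exists>g\<in>carrier PGL. skew S (pgl_image g S) \<and> (\<forall>T\<in>F - {S}. pgl_image g T = T)"
    using assms(1)[unfolded msr_family_4_2_def, THEN conjunct1]
      assms(1)[unfolded msr_family_4_2_def, THEN conjunct2] .
  from bspec[OF this(2) assms(2)] obtain g
    where g: "g \<in> carrier PGL" "skew S (pgl_image g S)" "\<forall>T\<in>F - {S}. pgl_image g T = T"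
    by (elim bexE conjE)
  obtain A where A: "invertible A" "g = scalar_matrices #>\<^bsub>GL\<^esub> A"
    using g(1) by (auto simp: PGL_def FactGroup_def RCOSETS_def GL_def)
  have image: "pgl_image g T = (*v) A ` T" if "T \<in> F" for T
    unfolding A(2) using lines that by (intro pgl_image_coset) simp
  show ?thesis
  proof
    show "invertible A" by fact
    show "skew S ((*v) A ` S)" using g(2) by (simp only: image[OF assms(2)])
    show "(*v) A ` T = T" if "T \<in> F" "T \<noteq> S" for T
      using g(3) that image[OF that(1)] by simp
  qed
qed

lemma invertible_mult_eq_0: "invertible A \<Longrightarrow> A *v x = 0 \<longleftrightarrow> x = 0" for A :: "'a::field ^ 'n ^ 'n"
  by (metis invertible_def matrix_vector_mul_assoc matrix_vector_mul_lid matrix_vector_mult_0_right)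

text \<open>Since a moved line is skew to its image, the moving matrix takes every nonzero vector of the line out
  of the line; in particular the line contains no eigenvector.\<close>

lemma msr_mover:
  assumes "msr_family_4_2 F" "S \<in> F"
  obtains A where "invertible A" "\<And>x. x \<in> S \<Longrightarrow> A *v x \<in> S \<Longrightarrow> x = 0"
    "\<And>T. T \<in> F \<Longrightarrow> T \<noteq> S \<Longrightarrow> stabilizes A T"
proof -
  obtain A where A: "invertible A" "skew S ((*v) A ` S)"
    "\<And>T. T \<in> F \<Longrightarrow> T \<noteq> S \<Longrightarrow> (*v) A ` T = T"
    using msr_matrix[OF assms] by metis
  show ?thesis
  proof
    show "invertible A" by fact
    show "x = 0" if "x \<in> S" "A *v x \<in> S" for x
    proof -
      have "A *v x = 0" using A(2) that by blast
      then show ?thesis by (simp add: invertible_mult_eq_0[OF A(1)])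
    qed
    show "stabilizes A T" if "T \<in> F" "T \<noteq> S" for T
      using A(3)[OF that] by blast
  qed
qed

section \<open>Three pairwise skew lines\<close>

text \<open>Three pairwise meeting lines are concurrent or coplanar. Neither is possible, because the common point
  or plane is already determined by two of the lines, and therefore fixed by the matrix that moves the third.\<close>

lemma no_three_pairwise_meeting:
  fixes F :: "('a::field ^ 4) set set"
  assumes F: "msr_family_4_2 F" "S \<in> F" "T \<in> F" "R \<in> F"
    and ne: "S \<noteq> T" "S \<noteq> R" "T \<noteq> R"
    and meet: "\<not> skew S T" "\<not> skew S R" "\<not> skew T R"
  shows False
proof -
  have line: "line S" "line T" "line R" using F msr_line by auto
  then have sub: "vec.subspace S" "vec.subspace T" "vec.subspace R" by (auto simp: line_def)
  then have zero: "0 \<in> S" "0 \<in> T" "0 \<in> R" by (auto intro: vec.subspace_0)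
  obtain A where A: "invertible A" "skew S ((*v) A ` S)" "(*v) A ` T = T" "(*v) A ` R = R"
    using msr_matrix[OF F(1,2)] F ne by metis
  obtain x where x: "x \<in> S" "x \<in> T" "x \<noteq> 0" using meet(1) zero by blast
  obtain y where y: "y \<in> S" "y \<in> R" "y \<noteq> 0" using meet(2) zero by blast
  obtain p where p: "p \<in> T" "p \<in> R" "p \<noteq> 0" using meet(3) zero by blast
  \<comment> \<open>Not concurrent: \<open>p\<close> spans \<open>T \<inter> R\<close>, hence is an eigenvector of \<open>A\<close> and cannot lie on \<open>S\<close>.\<close>
  have pS: "p \<notin> S"
  proof
    assume "p \<in> S"
    obtain c where c: "A *v p = c *s p"
      using meet_multiple[OF line(2,3) ne(3) p] A(3,4) p by blast
    then have "A *v p \<in> S" using vec.subspace_scale[OF sub(1)] \<open>p \<in> S\<close> by metis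
    then have "A *v p = 0" using \<open>p \<in> S\<close> A(2) by blast
    with A(1) p(3) show False by (simp add: invertible_mult_eq_0)
  qed
  have "indep2 x y"
  proof (rule indep2I[OF x(3)])
    fix c show "y \<noteq> c *s x"
    proof
      assume "y = c *s x"
      then have "y \<in> T" using vec.subspace_scale[OF sub(2)] x by blast
      then obtain d where "p = d *s y"
        using meet_multiple[OF line(2,3) ne(3) _ y(2,3) p(1,2)] by blast
      with y pS show False using vec.subspace_scale[OF sub(1)] by blast
    qed
  qed
  then have S: "S = vec.span {x, y}" using line_span line x y by blast
  \<comment> \<open>Not coplanar: \<open>H\<close> is a plane containing \<open>S\<close> and fixed by \<open>A\<close>, so it contains the image of \<open>S\<close>
    too; but two skew lines span the whole space.\<close>
  define H where "H = {t + r |t r. t \<in> T \<and> r \<in> R}"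
  have subH: "vec.subspace H" unfolding H_def using vec.subspace_sums sub by blast
  have TR: "T \<subseteq> H" "R \<subseteq> H" unfolding H_def using zero by force+
  then have "x \<in> H" "y \<in> H" using x y by auto
  then have SH: "S \<subseteq> H" unfolding S using subH by (simp add: vec.span_minimal)
  have AH: "A *v h \<in> H" if "h \<in> H" for h
    using that A(3,4) unfolding H_def by (force simp: matrix_vector_right_distrib)
  have "UNIV \<subseteq> H"
  proof
    fix z
    have "line ((*v) A ` S)"
    proof -
      have "vec.subspace ((*v) A ` S)" using sub(1) by (simp add: matrix_vector_mul_linear_gen vec.linear_subspace_image)
      moreover have "vec.dim ((*v) A ` S) = vec.dim S"
        by (rule vec.dim_image_eq) (auto simp: matrix_vector_mul_linear_gen intro: inj_on_subset[OF inj_matrix_vector_mult[OF A(1)]])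
      ultimately show ?thesis using line(1) by (simp add: line_def)
    qed
    then obtain s t where "s \<in> S" "t \<in> (*v) A ` S" "z = s + t"
      using skew_decompose[OF line(1) _ A(2)] by metis
    then show "z \<in> H" using SH AH subH vec.subspace_add by blast
  qed
  then have "vec.dim H = vec.dim (UNIV :: ('a ^ 4) set)" by (simp add: top.extremum_unique)
  also have "\<dots> = 4"
    by (simp only: vec.dim_UNIV vec.dimension_def card_cart_basis) simp
  finally have "vec.dim (T \<inter> R) = 0"
    using vec.dim_sums_Int[OF sub(2,3), folded H_def] line(2,3)
    unfolding line_def by linarith
  then have "T \<inter> R \<subseteq> {0}" by (simp only: vec.dim_eq_0)
  with p show False by blast
qed

text \<open>The Ramsey bound \<open>R(3,3) \<le> 6\<close>, to be applied to skewness.\<close>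

lemma ramsey_3_3:
  assumes sym: "\<And>x y. R x y \<Longrightarrow> R y x"
    and no_three_unrelated: "\<And>x y z. x \<in> X \<Longrightarrow> y \<in> X \<Longrightarrow> z \<in> X \<Longrightarrow> x \<noteq> y \<Longrightarrow> x \<noteq> z \<Longrightarrow> y \<noteq> z \<Longrightarrow>
                 \<not> R x y \<Longrightarrow> \<not> R x z \<Longrightarrow> \<not> R y z \<Longrightarrow> False"
    and card: "card X \<ge> 6"
  obtains x y z where "x \<in> X" "y \<in> X" "z \<in> X" "x \<noteq> y" "x \<noteq> z" "y \<noteq> z" "R x y" "R x z" "R y z"
proof -
  have fin: "finite X" using card by (metis card.infinite not_numeral_le_zero)
  obtain v where v: "v \<in> X" using card by fastforce
  \<comment> \<open>Of the five other elements, three are alike in their relation to \<open>v\<close>.\<close>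
  define N where "N = {y \<in> X - {v}. \<not> R v y}"
  define M where "M = {y \<in> X - {v}. R v y}"
  have "X - {v} = N \<union> M" "N \<inter> M = {}" unfolding N_def M_def by auto
  then have "card N + card M = card (X - {v})"
    using fin by (metis card_Un_disjoint finite_Diff finite_Un)
  then have "card N \<ge> 3 \<or> card M \<ge> 3" using card v fin by (simp add: card_Diff_singleton) linarith
  then obtain Y where Y: "Y \<subseteq> N \<or> Y \<subseteq> M" "card Y = 3"
    by (metis obtain_subset_with_card_n)
  obtain a b c where abc: "Y = {a, b, c}" "a \<noteq> b" "b \<noteq> c" "a \<noteq> c"
    using Y(2) by (auto simp: card_3_iff)
  from Y(1) show ?thesis
  proof
    assume "Y \<subseteq> N"
    then have *: "a \<in> X" "b \<in> X" "c \<in> X" "\<not> R v a" "\<not> R v b" "\<not> R v c" "v \<noteq> a" "v \<noteq> b" "v \<noteq> c"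
      using abc by (auto simp: N_def)
    have "R a b" using no_three_unrelated[of v a b] v * abc by blast
    moreover have "R a c" using no_three_unrelated[of v a c] v * abc by blast
    moreover have "R b c" using no_three_unrelated[of v b c] v * abc by blast
    ultimately show ?thesis using *(1-3) abc(2-4) by (intro that[of a b c])
  next
    assume "Y \<subseteq> M"
    then have *: "a \<in> X" "b \<in> X" "c \<in> X" "R v a" "R v b" "R v c" "v \<noteq> a" "v \<noteq> b" "v \<noteq> c"
      using abc by (auto simp: M_def)
    have "R a b \<or> R a c \<or> R b c" using no_three_unrelated[of a b c] * abc by blast
    then show ?thesis
      using that[OF v *(1,2,7,8) abc(2) *(4,5)] that[OF v *(1,3,7,9) abc(4) *(4,6)]
        that[OF v *(2,3,8,9) abc(3) *(5,6)] by satx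
  qed
qed

section \<open>Matrices fixing three skew lines\<close>

text \<open>A line skew to \<open>T\<close> is the graph of a linear map from a fixed complement of \<open>T\<close> to \<open>T\<close>; here the map
  sends \<open>x\<close> to \<open>s\<close> and \<open>y\<close> to \<open>t\<close>.\<close>

lemma graph_over:
  assumes "line U" "line T" "line L" "skew U T" "skew L T" "U = vec.span {x, y}" "indep2 x y"
  obtains s t where "s \<in> T" "t \<in> T" "L = vec.span {x + s, y + t}"
proof -
  have sub: "vec.subspace T" "vec.subspace U" using assms(1,2) by (auto simp: line_def)
  obtain l s where ls: "l \<in> L" "s \<in> T" "x = l + s"
    using skew_decompose[OF assms(3,2,5), of x] by blast
  obtain m t where mt: "m \<in> L" "t \<in> T" "y = m + t"
    using skew_decompose[OF assms(3,2,5), of y] by blast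
  have "indep2 l m" unfolding indep2_def
  proof (intro allI impI)
    fix a b assume ab: "a *s l + b *s m = 0"
    have 1: "a *s x + b *s y \<in> U" using assms(6) by (auto simp: in_span_pair)
    have 2: "- (a *s s + b *s t) \<in> T"
      using sub ls mt by (intro vec.subspace_neg vec.subspace_add vec.subspace_scale)
    have "(a *s x + b *s y) + - (a *s s + b *s t) = a *s l + b *s m"
      unfolding ls(3) mt(3) by (simp add: vec_eq_iff algebra_simps)
    then have "a *s x + b *s y = 0"
      using skew_sum_eq_0(1)[OF sub(1) assms(4) 1 2] ab by simp
    then show "a = 0 \<and> b = 0" using assms(7) unfolding indep2_def by blast
  qed
  then have "L = vec.span {l, m}" using line_span assms(3) ls mt by blast
  moreover have "l = x + - s" "m = y + - t" using ls mt by simp_all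
  ultimately have "L = vec.span {x + - s, y + - t}" by simp
  then show ?thesis
    by (rule that[OF vec.subspace_neg[OF sub(1) ls(2)] vec.subspace_neg[OF sub(1) mt(2)]])
qed

text \<open>The normal form of three pairwise skew lines: \<open>W\<close> is the graph of an isomorphism from \<open>U\<close> to \<open>V\<close>, and the
  basis of \<open>V\<close> is the image of that of \<open>U\<close>.\<close>

lemma skew_frame:
  assumes "line U" "line V" "line W" "skew U V" "skew U W" "skew V W"
  obtains x y z w where "U = vec.span {x, y}" "V = vec.span {z, w}"
    "W = vec.span {x + z, y + w}" "indep2 x y" "indep4 x y z w"
proof -
  obtain x y where xy: "indep2 x y" "U = vec.span {x, y}" by (rule line_basis[OF assms(1)])
  have "skew W V" using assms(6) by blast
  then obtain z w where zw: "z \<in> V" "w \<in> V" "W = vec.span {x + z, y + w}"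
    by (rule graph_over[OF assms(1,2,3,4) _ xy(2,1)])
  have sub: "vec.subspace U" "vec.subspace W" using assms by (auto simp: line_def)
  have "indep2 z w" unfolding indep2_def
  proof (intro allI impI)
    fix a b assume ab: "a *s z + b *s w = 0"
    have 1: "a *s x + b *s y \<in> U" using xy(2) by (auto simp: in_span_pair)
    have "a *s (x + z) + b *s (y + w) \<in> W" using zw(3) by (auto simp: in_span_pair)
    moreover have "a *s (x + z) + b *s (y + w) = (a *s x + b *s y) + (a *s z + b *s w)"
      by (simp add: vec_eq_iff algebra_simps)
    ultimately have "a *s x + b *s y \<in> W" using ab by simp
    then have "a *s x + b *s y = 0" using 1 assms(5) by blast
    then show "a = 0 \<and> b = 0" using xy(1) unfolding indep2_def by blast
  qed
  then have "V = vec.span {z, w}" using line_span assms(2) zw by blast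
  then show ?thesis
    using that xy zw(3) indep4_skew \<open>indep2 z w\<close> assms(4) by blast
qed

lemma diagonal_action_column:
  assumes ind: "indep4 x y z w"
    and U: "A *v u \<in> vec.span {x, y}" and V: "A *v v \<in> vec.span {z, w}"
    and W: "A *v (u + v) \<in> vec.span {x + z, y + w}"
  shows "\<exists>a c. A *v u = a *s x + c *s y \<and> A *v v = a *s z + c *s w"
proof -
  obtain a c where ac: "A *v u = a *s x + c *s y" using U by (auto simp: in_span_pair)
  obtain a' c' where ac': "A *v v = a' *s z + c' *s w" using V by (auto simp: in_span_pair)
  obtain p q where pq: "A *v (u + v) = p *s (x + z) + q *s (y + w)"
    using W by (auto simp: in_span_pair)
  have "a *s x + c *s y + a' *s z + c' *s w = A *v (u + v)"
    by (simp add: matrix_vector_right_distrib ac ac' add.assoc)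
  also have "\<dots> = p *s x + q *s y + p *s z + q *s w"
    unfolding pq by (simp add: vec_eq_iff algebra_simps)
  finally have "a = p" "c = q" "a' = p" "c' = q" by (rule indep4_coefficients[OF ind])+
  then show ?thesis using ac ac' by blast
qed

text \<open>In these coordinates a matrix that fixes the three lines acts on \<open>U\<close> and on \<open>V\<close> by the same \<open>2 \<times> 2\<close> matrix,
  because it has to respect the isomorphism whose graph is the third line.\<close>

lemma diagonal_action:
  assumes "indep4 x y z w" "stabilizes A (vec.span {x, y})" "stabilizes A (vec.span {z, w})"
    "stabilizes A (vec.span {x + z, y + w})"
  obtains a b c d where "A *v x = a *s x + c *s y" "A *v y = b *s x + d *s y"
    "A *v z = a *s z + c *s w" "A *v w = b *s z + d *s w"
proof -
  have "\<exists>a c. A *v x = a *s x + c *s y \<and> A *v z = a *s z + c *s w"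
    using assms(2-4) by (intro diagonal_action_column[OF assms(1)]) (auto intro: vec.span_base)
  moreover have "\<exists>b d. A *v y = b *s x + d *s y \<and> A *v w = b *s z + d *s w"
    using assms(2-4) by (intro diagonal_action_column[OF assms(1)]) (auto intro: vec.span_base)
  ultimately show ?thesis using that by blast
qed

text \<open>Such an action fixes the graph of a \<open>2 \<times> 2\<close> matrix exactly when it commutes with that matrix. The
  three equations are the commutation relations, written as vanishing minors: the vectors of
  off-diagonal entries and difference of the diagonal entries of the two matrices are parallel.\<close>

lemma graph_stabilizer_commutes:
  assumes ind: "indep4 x y z w"
    and A: "A *v x = a *s x + c *s y" "A *v y = b *s x + d *s y"
    "A *v z = a *s z + c *s w" "A *v w = b *s z + d *s w"
    and l: "l = x + (n11 *s z + n21 *s w)" and m: "m = y + (n12 *s z + n22 *s w)"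
    and L: "stabilizes A (vec.span {l, m})"
  shows "b * n21 = c * n12" "c * (n11 - n22) = n21 * (a - d)" "b * (n11 - n22) = n12 * (a - d)"
proof -
  note simps = A matrix_vector_right_distrib vector_scalar_commute
  \<comment> \<open>The coordinates at \<open>x\<close> and \<open>y\<close> determine how the images of \<open>l\<close> and \<open>m\<close> combine \<open>l\<close> and \<open>m\<close>; those at \<open>z\<close>
    and \<open>w\<close> are the entries of the two matrix products.\<close>
  have "A *v l \<in> vec.span {l, m}" "A *v m \<in> vec.span {l, m}" using L by (auto intro: vec.span_base)
  then obtain p q p' q' where pq: "A *v l = p *s l + q *s m" "A *v m = p' *s l + q' *s m"
    by (auto simp: in_span_pair)
  have "a *s x + c *s y + (n11 * a + n21 * b) *s z + (n11 * c + n21 * d) *s w = A *v l"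
    unfolding l by (simp add: simps) (simp add: vec_eq_iff algebra_simps)
  also have "\<dots> = p *s x + q *s y + (p * n11 + q * n12) *s z + (p * n21 + q * n22) *s w"
    unfolding pq unfolding l m by (simp add: vec_eq_iff algebra_simps)
  finally have 1: "a = p" "c = q" "n11 * a + n21 * b = p * n11 + q * n12"
      "n11 * c + n21 * d = p * n21 + q * n22"
    by (rule indep4_coefficients[OF ind])+
  have "b *s x + d *s y + (n12 * a + n22 * b) *s z + (n12 * c + n22 * d) *s w = A *v m"
    unfolding m by (simp add: simps) (simp add: vec_eq_iff algebra_simps)
  also have "\<dots> = p' *s x + q' *s y + (p' * n11 + q' * n12) *s z + (p' * n21 + q' * n22) *s w"
    unfolding pq unfolding l m by (simp add: vec_eq_iff algebra_simps)
  finally have 2: "b = p'" "d = q'" "n12 * a + n22 * b = p' * n11 + q' * n12"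
    by (rule indep4_coefficients[OF ind])+
  show "b * n21 = c * n12" using 1 by (simp add: algebra_simps)
  show "c * (n11 - n22) = n21 * (a - d)" using 1 by (simp add: algebra_simps)
  show "b * (n11 - n22) = n12 * (a - d)" using 2 by (simp add: algebra_simps)
qed

lemma proportional_of_minors:
  fixes b c e k l m :: "'a::field"
  assumes "b * l = c * k" "c * m = l * e" "b * m = k * e" "k \<noteq> 0 \<or> l \<noteq> 0 \<or> m \<noteq> 0"
  shows "\<exists>t. b = t * k \<and> c = t * l \<and> e = t * m"
proof -
  consider "k \<noteq> 0" | "l \<noteq> 0" | "m \<noteq> 0" using assms(4) by blast
  then show ?thesis
  proof cases
    case 1
    with assms(1-3) show ?thesis by (intro exI[of _ "b / k"]) (simp add: field_simps)
  next
    case 2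
    with assms(1-3) show ?thesis by (intro exI[of _ "c / l"]) (simp add: field_simps)
  next
    case 3
    with assms(1-3) show ?thesis by (intro exI[of _ "e / m"]) (simp add: field_simps)
  qed
qed

text \<open>The commutant of a nonscalar \<open>2 \<times> 2\<close> matrix has dimension two, so it is spanned by the identity and any
  of its nonscalar elements. Both \<open>A\<close> and \<open>B\<close> act through the commutant of the matrix whose graph is \<open>L\<close>;
  the matrix \<open>C\<close> witnesses that the latter is not a scalar.\<close>

lemma stabilizer_pencil:
  fixes A B C :: "'a::field ^ 4 ^ 4"
  assumes lines: "line U" "line V" "line W" "line L"
    and skew: "skew U V" "skew U W" "skew V W" "skew L V"
    and A: "stabilizes A U" "stabilizes A V" "stabilizes A W" "stabilizes A L"
    and B: "stabilizes B U" "stabilizes B V" "stabilizes B W" "stabilizes B L"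
    and C: "stabilizes C U" "stabilizes C V" "stabilizes C W" "\<not> stabilizes C L"
    and nonscalar: "\<And>s. \<exists>v. A *v v \<noteq> s *s v"
  shows "\<exists>\<alpha> \<beta>. \<forall>v. B *v v = \<alpha> *s (A *v v) + \<beta> *s v"
proof -
  obtain x y z w where U: "U = vec.span {x, y}" and V: "V = vec.span {z, w}"
    and W: "W = vec.span {x + z, y + w}" and ind2: "indep2 x y" and ind: "indep4 x y z w"
    using skew_frame[OF lines(1-3) skew(1-3)] by metis
  have extend: "D *v v = E *v v"
    if "D *v x = E *v x" "D *v y = E *v y" "D *v z = E *v z" "D *v w = E *v w" for D E :: "'a ^ 4 ^ 4" and v
  proof -
    obtain u u' where u: "u \<in> U" "u' \<in> V" "v = u + u'"
      using skew_decompose[OF lines(1,2) skew(1), of v] by blast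
    obtain p q p' q' where "u = p *s x + q *s y" "u' = p' *s z + q' *s w"
      using u(1,2) unfolding U V in_span_pair by blast
    with u(3) that show ?thesis
      by (simp add: matrix_vector_right_distrib vector_scalar_commute)
  qed
  \<comment> \<open>Being skew to \<open>V\<close>, the line \<open>L\<close> is the graph of the matrix \<open>N\<close> with entries \<open>n11, n12, n21, n22\<close>,
    read as a map from \<open>U\<close> to \<open>V\<close>.\<close>
  obtain s t where st: "s \<in> V" "t \<in> V" "L = vec.span {x + s, y + t}"
    using graph_over[OF lines(1,2,4) skew(1,4) U ind2] by metis
  obtain n11 n21 n12 n22 where n: "s = n11 *s z + n21 *s w" "t = n12 *s z + n22 *s w"
    using st(1,2) unfolding V in_span_pair by blast
  note L = st(3)[unfolded n]
  obtain a b c d where a: "A *v x = a *s x + c *s y" "A *v y = b *s x + d *s y"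
    "A *v z = a *s z + c *s w" "A *v w = b *s z + d *s w"
    using diagonal_action[OF ind A(1-3)[unfolded U V W]] by metis
  obtain a' b' c' d' where b: "B *v x = a' *s x + c' *s y" "B *v y = b' *s x + d' *s y"
    "B *v z = a' *s z + c' *s w" "B *v w = b' *s z + d' *s w"
    using diagonal_action[OF ind B(1-3)[unfolded U V W]] by metis
  obtain a'' b'' c'' d'' where c: "C *v x = a'' *s x + c'' *s y" "C *v y = b'' *s x + d'' *s y"
    "C *v z = a'' *s z + c'' *s w" "C *v w = b'' *s z + d'' *s w"
    using diagonal_action[OF ind C(1-3)[unfolded U V W]] by metis
  \<comment> \<open>The graph of a scalar matrix is fixed by whatever acts on \<open>U\<close> and \<open>V\<close> by the same matrix, as \<open>C\<close> does.\<close>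
  have N: "n12 \<noteq> 0 \<or> n21 \<noteq> 0 \<or> n11 - n22 \<noteq> 0"
  proof (rule ccontr)
    assume "\<not> ?thesis"
    then have 0: "n12 = 0" "n21 = 0" "n22 = n11" by auto
    have "stabilizes C L"
    proof
      fix v assume "v \<in> L"
      then obtain p q where v: "v = p *s (x + n11 *s z) + q *s (y + n11 *s w)"
        unfolding L 0 by (auto simp: in_span_pair)
      have "C *v v = (p * a'' + q * b'') *s (x + n11 *s z) + (p * c'' + q * d'') *s (y + n11 *s w)"
        unfolding v by (simp add: matrix_vector_right_distrib vector_scalar_commute c)
          (simp add: vec_eq_iff algebra_simps)
      then show "C *v v \<in> L" unfolding L 0 in_span_pair by auto
    qed
    with C(4) show False by blast
  qed
  obtain \<tau> where \<tau>: "b = \<tau> * n12" "c = \<tau> * n21" "a - d = \<tau> * (n11 - n22)"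
    using proportional_of_minors[OF graph_stabilizer_commutes[OF ind a refl refl A(4)[unfolded L]] N] by blast
  obtain \<tau>' where \<tau>': "b' = \<tau>' * n12" "c' = \<tau>' * n21" "a' - d' = \<tau>' * (n11 - n22)"
    using proportional_of_minors[OF graph_stabilizer_commutes[OF ind b refl refl B(4)[unfolded L]] N] by blast
  \<comment> \<open>If \<open>\<tau>\<close> vanished, \<open>A\<close> would be a scalar.\<close>
  have "\<tau> \<noteq> 0"
  proof
    assume "\<tau> = 0"
    then have 0: "b = 0" "c = 0" "d = a" using \<tau> by auto
    have "A *v v = mat a *v v" for v
      by (rule extend) (simp_all add: a 0 mat_mult_vec)
    then have "A *v v = a *s v" for v by (simp add: mat_mult_vec)
    with nonscalar show False by blast
  qed
  define \<alpha> where "\<alpha> = \<tau>' / \<tau>"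
  have coef: "b' = \<alpha> * b" "c' = \<alpha> * c" "a' - d' = \<alpha> * (a - d)"
    unfolding \<tau> \<tau>' \<alpha>_def using \<open>\<tau> \<noteq> 0\<close> by simp_all
  define \<beta> where "\<beta> = a' - \<alpha> * a"
  have a': "a' = \<alpha> * a + \<beta>" "d' = \<alpha> * d + \<beta>" 
    using coef(3) by (auto simp: \<beta>_def algebra_simps)
  have D: "(mat \<alpha> ** A + mat \<beta>) *v v = \<alpha> *s (A *v v) + \<beta> *s v" for v
    by (simp add: matrix_vector_mult_add_rdistrib mat_mult_vec flip: matrix_vector_mul_assoc)
  have "B *v v = (mat \<alpha> ** A + mat \<beta>) *v v" for v
    by (rule extend; unfold D a b coef(1,2) a') (simp_all add: vec_eq_iff algebra_simps)
  then show ?thesis using D by metis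
qed

section \<open>Every further line is a transversal\<close>

text \<open>If \<open>L\<close> were skew to \<open>V\<close>, the matrices moving \<open>M\<close> and \<open>N\<close> would both fix \<open>U\<close>, \<open>V\<close>, \<open>W\<close> and \<open>L\<close>, hence each
  would be a linear combination of the other and the identity, and they would fix the same subspaces.\<close>

lemma fourth_line_meets_middle:
  assumes F: "msr_family_4_2 F" "{U, V, W, L, M, N} \<subseteq> F" and dist: "distinct [U, V, W, L, M, N]"
    and skew: "skew U V" "skew U W" "skew V W"
  shows "\<not> skew L V"
proof
  assume LV: "skew L V"
  have lines: "line U" "line V" "line W" "line L" "line M" "line N"
    using F msr_line by auto
  have mem: "U \<in> F" "V \<in> F" "W \<in> F" "L \<in> F" "M \<in> F" "N \<in> F" using F(2) by auto
  obtain C where "invertible C" and C: "\<And>x. x \<in> L \<Longrightarrow> C *v x \<in> L \<Longrightarrow> x = 0" "\<And>T. T \<in> F \<Longrightarrow> T \<noteq> L \<Longrightarrow> stabilizes C T"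
    using msr_mover[OF F(1) mem(4)] by metis
  obtain A where "invertible A" and A: "\<And>x. x \<in> M \<Longrightarrow> A *v x \<in> M \<Longrightarrow> x = 0" "\<And>T. T \<in> F \<Longrightarrow> T \<noteq> M \<Longrightarrow> stabilizes A T"
    using msr_mover[OF F(1) mem(5)] by metis
  obtain B where "invertible B" and B: "\<And>x. x \<in> N \<Longrightarrow> B *v x \<in> N \<Longrightarrow> x = 0" "\<And>T. T \<in> F \<Longrightarrow> T \<noteq> N \<Longrightarrow> stabilizes B T"
    using msr_mover[OF F(1) mem(6)] by metis
  obtain l where l: "l \<in> L" "l \<noteq> 0" by (rule line_nonzero[OF lines(4)])
  obtain m where m: "m \<in> M" "m \<noteq> 0" by (rule line_nonzero[OF lines(5)])
  obtain n where n: "n \<in> N" "n \<noteq> 0" by (rule line_nonzero[OF lines(6)])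
  have sub: "vec.subspace M" "vec.subspace N" using lines by (auto simp: line_def)
  have "\<exists>\<alpha> \<beta>. \<forall>v. B *v v = \<alpha> *s (A *v v) + \<beta> *s v"
  proof (rule stabilizer_pencil[OF lines(1-4) skew LV])
    show "stabilizes A U" "stabilizes A V" "stabilizes A W" "stabilizes A L"
      by (rule A(2); use mem dist in auto)+
    show "stabilizes B U" "stabilizes B V" "stabilizes B W" "stabilizes B L"
      by (rule B(2); use mem dist in auto)+
    show "stabilizes C U" "stabilizes C V" "stabilizes C W"
      by (rule C(2); use mem dist in auto)+
    show "\<not> stabilizes C L" using C(1) l by blast
    show "\<exists>v. A *v v \<noteq> s *s v" for s
    proof
      show "A *v m \<noteq> s *s m"
        using A(1)[OF m(1)] m vec.subspace_scale[OF sub(1) m(1), of s] by auto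
    qed
  qed
  \<comment> \<open>So \<open>B\<close> fixes \<open>N\<close> along with \<open>A\<close>, although \<open>B\<close> was chosen to move \<open>N\<close>.\<close>
  then obtain \<alpha> \<beta> where "B *v n = \<alpha> *s (A *v n) + \<beta> *s n" by blast
  moreover have "stabilizes A N" by (rule A(2)) (use mem dist in auto)
  then have "A *v n \<in> N" using n(1) by (rule bspec)
  ultimately have "B *v n \<in> N"
    using n(1) sub(2) by (simp add: vec.subspace_add vec.subspace_scale)
  with B(1) n show False by blast
qed

lemma fourth_line_meets:
  assumes F: "msr_family_4_2 F" "card F \<ge> 6" and mem: "U \<in> F" "V \<in> F" "W \<in> F" "L \<in> F"
    and dist: "distinct [U, V, W, L]"
    and skew: "skew U V" "skew U W" "skew V W"
  shows "\<not> skew L U" "\<not> skew L V" "\<not> skew L W"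
proof -
  have "card {U, V, W, L} = 4" using dist by simp
  then have "card (F - {U, V, W, L}) \<ge> 2"
    using mem F(2) by (subst card_Diff_subset) auto
  then obtain Y where "Y \<subseteq> F - {U, V, W, L}" "card Y = 2"
    by (metis obtain_subset_with_card_n)
  then obtain M N where MN: "M \<in> F - {U, V, W, L}" "N \<in> F - {U, V, W, L}" "M \<noteq> N"
    by (auto simp: card_2_iff)
  have skew': "skew V U" "skew W V" using skew(1,3) by (simp_all only: Int_commute)
  show "\<not> skew L U"
    by (rule fourth_line_meets_middle[OF F(1) _ _ skew'(1) skew(3,2), where M = M and N = N])
      (use MN mem dist in \<open>simp_all, metis?\<close>)
  show "\<not> skew L V"
    by (rule fourth_line_meets_middle[OF F(1) _ _ skew, where M = M and N = N])
      (use MN mem dist in \<open>simp_all, metis?\<close>)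
  show "\<not> skew L W"
    by (rule fourth_line_meets_middle[OF F(1) _ _ skew(2,1) skew'(2), where M = M and N = N])
      (use MN mem dist in \<open>simp_all, metis?\<close>)
qed

section \<open>Coordinates for a three by three grid of lines\<close>

text \<open>Spanning the transversal by its points on \<open>S\<close> and \<open>T\<close>, its point on \<open>R\<close> has two nonzero coordinates; these
  are absorbed into the two spanning vectors.\<close>

lemma transversal_points:
  assumes lines: "line L" "vec.subspace S" "vec.subspace T" "vec.subspace R"
    and skew: "skew S T" "skew S R" "skew T R"
    and meets: "\<not> skew L S" "\<not> skew L T" "\<not> skew L R"
  obtains s t where "s \<in> S" "s \<in> L" "t \<in> T" "t \<in> L" "s + t \<in> R" "s \<noteq> 0" "t \<noteq> 0"
proof -
  have sub: "vec.subspace L" using lines(1) by (simp add: line_def)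
  have zero: "0 \<in> L" "0 \<in> S" "0 \<in> T" "0 \<in> R" using sub lines(2-4) by (auto intro: vec.subspace_0)
  obtain s where s: "s \<in> L" "s \<in> S" "s \<noteq> 0" using meets(1) zero by blast
  obtain t where t: "t \<in> L" "t \<in> T" "t \<noteq> 0" using meets(2) zero by blast
  obtain r where r: "r \<in> L" "r \<in> R" "r \<noteq> 0" using meets(3) zero by blast
  have "L = vec.span {s, t}" using line_span_skew[OF lines(1-3) skew(1)] s t by blast
  then obtain a b where ab: "r = a *s s + b *s t" using r(1) by (auto simp: in_span_pair)
  have mem: "a *s s \<in> S" "a *s s \<in> L" "b *s t \<in> T" "b *s t \<in> L"
    using s t sub lines(2,3) by (auto intro: vec.subspace_scale)
  show ?thesis
  proof
    show "a *s s \<in> S" "a *s s \<in> L" "b *s t \<in> T" "b *s t \<in> L" by fact+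
    show "a *s s + b *s t \<in> R" using r(2) ab by simp
    show "a *s s \<noteq> 0"
    proof
      assume "a *s s = 0"
      then have "r \<in> T" using mem(3) by (simp only: ab add_0_left)
      then show False using r skew(3) by blast
    qed
    show "b *s t \<noteq> 0"
    proof
      assume "b *s t = 0"
      then have "r \<in> S" using mem(1) by (simp only: ab add_0_right)
      then show False using r skew(2) by blast
    qed
  qed
qed

text \<open>Two triples of pairwise skew lines, each line of one meeting each line of the other, lie in the two
  reguli of a hyperbolic quadric, and all such configurations are projectively equivalent.\<close>

lemma grid_frame:
  assumes U: "line U1" "line U2" "line U3" "skew U1 U2" "skew U1 U3" "skew U2 U3"
    and W: "line W1" "line W2" "line W3" "skew W1 W2" "skew W1 W3" "skew W2 W3"
    and meets: "\<not> skew W1 U1" "\<not> skew W1 U2" "\<not> skew W1 U3"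
      "\<not> skew W2 U1" "\<not> skew W2 U2" "\<not> skew W2 U3"
      "\<not> skew W3 U1" "\<not> skew W3 U2" "\<not> skew W3 U3"
  obtains e1 e2 e3 e4 where "indep4 e1 e3 e2 e4"
    "U1 = vec.span {e1, e3}" "U2 = vec.span {e2, e4}" "U3 = vec.span {e1 + e2, e3 + e4}"
    "W1 = vec.span {e1, e2}" "W2 = vec.span {e3, e4}" "W3 = vec.span {e1 + e3, e2 + e4}"
proof -
  have sub: "vec.subspace U1" "vec.subspace U2" "vec.subspace U3"
    "vec.subspace W1" "vec.subspace W2" "vec.subspace W3"
    using U W by (auto simp: line_def)
  have zero: "0 \<in> W3" "0 \<in> U2" using sub by (auto intro: vec.subspace_0)
  have meets': "\<not> skew U1 W1" "\<not> skew U1 W2" "\<not> skew U1 W3" using meets by (simp_all only: Int_commute not_False_eq_True)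
  have ne: "U1 \<noteq> W1" "U1 \<noteq> W2"
    using meets(2,5) U(4) by auto
  \<comment> \<open>The directions of \<open>e1, e2, e3, e4\<close> are forced as intersection points. The sums on \<open>U3\<close> fix the ratio
    of \<open>e1\<close> and \<open>e2\<close> and that of \<open>e3\<close> and \<open>e4\<close>; the sum of \<open>e1\<close> and \<open>e3\<close> on \<open>W3\<close> then fixes the
    factors \<open>a\<close> and \<open>b\<close>, which rescale each of the two pairs as a whole.\<close>
  obtain f1 f2 where f12: "f1 \<in> U1" "f1 \<in> W1" "f2 \<in> U2" "f2 \<in> W1" "f1 + f2 \<in> U3" "f1 \<noteq> 0" "f2 \<noteq> 0"
    by (rule transversal_points[OF W(1) sub(1-3) U(4-6) meets(1-3)])
  obtain f3 f4 where f34: "f3 \<in> U1" "f3 \<in> W2" "f4 \<in> U2" "f4 \<in> W2" "f3 + f4 \<in> U3" "f3 \<noteq> 0" "f4 \<noteq> 0"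
    by (rule transversal_points[OF W(2) sub(1-3) U(4-6) meets(4-6)])
  obtain e1 e3 where e13: "e1 \<in> W1" "e1 \<in> U1" "e3 \<in> W2" "e3 \<in> U1" "e1 + e3 \<in> W3" "e1 \<noteq> 0" "e3 \<noteq> 0"
    by (rule transversal_points[OF U(1) sub(4-6) W(4-6) meets'])
  obtain a where a: "e1 = a *s f1" using meet_multiple[OF U(1) W(1) ne(1)] f12 e13 by metis
  obtain b where b: "e3 = b *s f3" using meet_multiple[OF U(1) W(2) ne(2)] f34 e13 by metis
  have ab: "a \<noteq> 0" "b \<noteq> 0" using a b e13 by auto
  define e2 where "e2 = a *s f2"
  define e4 where "e4 = b *s f4"
  have e24: "e2 \<in> U2" "e2 \<in> W1" "e4 \<in> U2" "e4 \<in> W2" "e2 \<noteq> 0" "e4 \<noteq> 0"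
    using f12 f34 sub ab unfolding e2_def e4_def by (auto intro: vec.subspace_scale)
  have "a *s (f1 + f2) \<in> U3" "b *s (f3 + f4) \<in> U3"
    using f12(5) f34(5) sub(3) by (auto intro: vec.subspace_scale)
  then have U3: "e1 + e2 \<in> U3" "e3 + e4 \<in> U3"
    unfolding a b e2_def e4_def by (simp_all add: vector_add_ldistrib)
  have U1s: "U1 = vec.span {e1, e3}"
    by (rule line_span_skew[OF U(1) sub(4,5) W(4)]) (use e13 in auto)
  have U2s: "U2 = vec.span {e2, e4}"
    by (rule line_span_skew[OF U(2) sub(4,5) W(4)]) (use e24 in auto)
  have W1s: "W1 = vec.span {e1, e2}"
    by (rule line_span_skew[OF W(1) sub(1,2) U(4)]) (use e13 e24 in auto)
  have W2s: "W2 = vec.span {e3, e4}"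
    by (rule line_span_skew[OF W(2) sub(1,2) U(4)]) (use e13 e24 in auto)
  have sums: "e1 + e2 \<in> W1" "e3 + e4 \<in> W2" "e1 + e3 \<in> U1" "e2 + e4 \<in> U2"
    using e13 e24 sub by (auto intro: vec.subspace_add)
  have nonzero: "e1 + e2 \<noteq> 0" "e3 + e4 \<noteq> 0" "e1 + e3 \<noteq> 0" "e2 + e4 \<noteq> 0"
    by (rule skew_sum_nonzero[OF sub(2) U(4) e13(2) e24(1) e13(6)]
        skew_sum_nonzero[OF sub(2) U(4) e13(4) e24(3) e13(7)]
        skew_sum_nonzero[OF sub(5) W(4) e13(1,3,6)]
        skew_sum_nonzero[OF sub(5) W(4) e24(2,4,5)])+
  have U3s: "U3 = vec.span {e1 + e2, e3 + e4}"
    by (rule line_span_skew[OF U(3) sub(4,5) W(4)]) (use U3 sums nonzero in auto)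
  have ind: "indep4 e1 e3 e2 e4"
  proof (rule indep4_skew)
    show "skew (vec.span {e1, e3}) (vec.span {e2, e4})" using U(4) U1s U2s by simp
    show "indep2 e1 e3" by (rule indep2_skew[OF sub(4,5) W(4) e13(1,3,6,7)])
    show "indep2 e2 e4" by (rule indep2_skew[OF sub(4,5) W(4) e24(2,4,5,6)])
  qed
  \<comment> \<open>No scaling is left, but \<open>W3\<close> must also meet \<open>U2\<close> and \<open>U3\<close>: comparing coordinates of the point \<open>z\<close> of
    \<open>U3\<close> forces \<open>h\<close> to be proportional to \<open>e2 + e4\<close>.\<close>
  obtain h where h: "h \<in> W3" "h \<in> U2" "h \<noteq> 0" using meets(8) zero by blast
  obtain m n where mn: "h = m *s e2 + n *s e4" using h(2) unfolding U2s in_span_pair by blast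
  have W3h: "W3 = vec.span {e1 + e3, h}"
    by (rule line_span_skew[OF W(3) sub(1,2) U(4)]) (use h e13 sums nonzero in auto)
  obtain z where z: "z \<in> W3" "z \<in> U3" "z \<noteq> 0"
    using meets(9) vec.subspace_0[OF sub(3)] zero by blast
  obtain p q where pq: "z = p *s (e1 + e2) + q *s (e3 + e4)" using z(2) unfolding U3s in_span_pair by blast
  obtain f g where fg: "z = f *s (e1 + e3) + g *s h" using z(1) unfolding W3h in_span_pair by blast
  have "p *s e1 + q *s e3 + p *s e2 + q *s e4 = z"
    unfolding pq by (simp add: vec_eq_iff algebra_simps)
  also have "\<dots> = f *s e1 + f *s e3 + (g * m) *s e2 + (g * n) *s e4"
    unfolding fg mn by (simp add: vec_eq_iff algebra_simps)
  finally have eqs: "p = f" "q = f" "p = g * m" "q = g * n" by (rule indep4_coefficients[OF ind])+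
  have f: "f \<noteq> 0" using eqs(1,2) z(3) pq by auto
  have "f *s (e2 + e4) = g *s h"
    unfolding mn using eqs by (simp add: vector_add_ldistrib vector_smult_assoc)
  then have "inverse f *s (f *s (e2 + e4)) \<in> W3"
    using h(1) sub(6) by (metis vec.subspace_scale)
  then have "e2 + e4 \<in> W3" using f by (simp add: vector_smult_assoc)
  then have W3s: "W3 = vec.span {e1 + e3, e2 + e4}"
    by (intro line_span_skew[OF W(3) sub(1,2) U(4)]) (use e13 sums nonzero in auto)
  show ?thesis by (rule that[OF ind U1s U2s U3s W1s W2s W3s])
qed

text \<open>The inverse of the matrix with columns \<open>e1, e2, e3, e4\<close>.\<close>

lemma indep4_to_axis:
  fixes e1 :: "'a::field ^ 4"
  assumes "indep4 e1 e2 e3 e4"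
  obtains A :: "'a ^ 4 ^ 4" where "invertible A" "A *v e1 = axis 1 1" "A *v e2 = axis 2 1"
    "A *v e3 = axis 3 1" "A *v e4 = axis 4 1"
proof -
  define P :: "'a ^ 4 ^ 4" where "P = (\<chi> i j. if j = 1 then e1 $ i else if j = 2 then e2 $ i
    else if j = 3 then e3 $ i else e4 $ i)"
  have P: "P *v v = v $ 1 *s e1 + v $ 2 *s e2 + v $ 3 *s e3 + v $ 4 *s e4" for v
    unfolding P_def by (simp add: vec_eq_iff matrix_vector_mult_def sum_4 mult.commute)
  have "v = 0" if "P *v v = 0" for v
  proof -
    have "v $ 1 = 0 \<and> v $ 2 = 0 \<and> v $ 3 = 0 \<and> v $ 4 = 0"
      using assms[unfolded indep4_def, rule_format, OF that[unfolded P]] .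
    then show ?thesis by (simp add: vec_eq_iff forall_4)
  qed
  then have "inj ((*v) P)" by (simp add: vec.inj_iff_eq_0)
  then obtain A where A: "A ** P = mat 1" by (auto simp flip: matrix_left_invertible_injective)
  then have "invertible A" using matrix_left_right_inverse[of A P] unfolding invertible_def by blast
  moreover have "A *v (P *v v) = v" for v by (simp add: A matrix_vector_mul_assoc)
  moreover have "P *v axis 1 1 = e1" "P *v axis 2 1 = e2" "P *v axis 3 1 = e3" "P *v axis 4 1 = e4"
    unfolding P by (simp_all add: axis_def)
  ultimately show ?thesis by (intro that[of A]) metis+
qed

lemma isomorphic_familiesI:
  assumes "invertible A" "\<And>S. S \<in> F \<Longrightarrow> vec.subspace S" "(\<lambda>S. (*v) A ` S) ` F = G"
  shows "isomorphic_families F G"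
proof -
  have "scalar_matrices #>\<^bsub>GL\<^esub> A \<in> carrier PGL"
    using assms(1) by (auto simp: PGL_def FactGroup_def RCOSETS_def GL_def)
  moreover have "pgl_image (scalar_matrices #>\<^bsub>GL\<^esub> A) ` F = (\<lambda>S. (*v) A ` S) ` F"
    using assms(2) by (intro image_cong refl pgl_image_coset)
  ultimately show ?thesis using assms(3) unfolding isomorphic_families_def by blast
qed

lemma matrix_image_span: "(*v) A ` vec.span S = vec.span ((*v) A ` S)" for A :: "'a::field ^ 'n ^ 'm"
  using vec.linear_span_image[OF matrix_vector_mul_linear_gen, of A S] by simp

lemma frame_isomorphic_six_subspaces:
  fixes e1 :: "'a::field ^ 4"
  assumes "indep4 e1 e3 e2 e4"
  shows "isomorphic_families {vec.span {e1, e3}, vec.span {e2, e4}, vec.span {e1 + e2, e3 + e4},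
    vec.span {e1, e2}, vec.span {e3, e4}, vec.span {e1 + e3, e2 + e4}} six_subspaces"
proof -
  have "indep4 e1 e2 e3 e4"
    unfolding indep4_def
  proof (intro allI impI)
    fix a b c d assume "a *s e1 + b *s e2 + c *s e3 + d *s e4 = 0"
    then have "a *s e1 + c *s e3 + b *s e2 + d *s e4 = 0" by (simp add: ac_simps)
    then show "a = 0 \<and> b = 0 \<and> c = 0 \<and> d = 0" using assms unfolding indep4_def by blast
  qed
  then obtain A :: "'a ^ 4 ^ 4" where A: "invertible A" "A *v e1 = axis 1 1" "A *v e2 = axis 2 1"
    "A *v e3 = axis 3 1" "A *v e4 = axis 4 1" by (rule indep4_to_axis)
  show ?thesis
  proof (rule isomorphic_familiesI[OF A(1)])
    show "vec.subspace S" if "S \<in> {vec.span {e1, e3}, vec.span {e2, e4}, vec.span {e1 + e2, e3 + e4},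
      vec.span {e1, e2}, vec.span {e3, e4}, vec.span {e1 + e3, e2 + e4}}" for S
      using that by (elim insertE emptyE) (simp_all only: vec.subspace_span)
  qed (simp add: six_subspaces_def Let_def matrix_image_span A matrix_vector_right_distrib)
qed

section \<open>The bound and the extremal family\<close>

lemma nonzero_eq_1_of_card_less_3:
  fixes c :: "'a::{field, finite}"
  assumes "CARD('a) < 3" "c \<noteq> 0"
  shows "c = 1"
proof (rule ccontr)
  assume "c \<noteq> 1"
  with assms(2) have "card {0, 1, c} = 3" by auto
  with assms(1) card_mono[of "UNIV :: 'a set" "{0, 1, c}"] show False by simp
qed

theorem theorem1p1:
  fixes q :: nat and \<S> :: "('a::{field,finite} ^ 4) set set"
  assumes "CARD('a) = q"
    and "msr_family_4_2 \<S>"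
  shows "card \<S> \<le> 6 \<and> (card \<S> = 6 \<longrightarrow> q \<ge> 3 \<and> isomorphic_families \<S> six_subspaces)"
proof (cases "card \<S> \<ge> 6")
  case False
  then show ?thesis by simp
next
  case ge6: True
  note line = msr_line[OF assms(2)]
  have skew_sym: "skew T S" if "skew S T" for S T :: "('a ^ 4) set"
    using that by (simp only: Int_commute)
  obtain U1 U2 U3 where U: "U1 \<in> \<S>" "U2 \<in> \<S>" "U3 \<in> \<S>" "U1 \<noteq> U2" "U1 \<noteq> U3" "U2 \<noteq> U3"
    "skew U1 U2" "skew U1 U3" "skew U2 U3"
    by (rule ramsey_3_3[OF skew_sym no_three_pairwise_meeting[OF assms(2)] ge6])
  \<comment> \<open>The rest of the family is transversal to all three; two members of the rest that met would form a
    triangle with \<open>U1\<close>, so the rest is pairwise skew as well.\<close>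
  define X where "X = \<S> - {U1, U2, U3}"
  have X: "W \<in> \<S>" "W \<noteq> U1" "W \<noteq> U2" "W \<noteq> U3" if "W \<in> X" for W
    using that by (simp_all add: X_def)
  have "card {U1, U2, U3} = 3" using U by simp
  then have cardX: "card X = card \<S> - 3"
    unfolding X_def using U(1-3) by (simp add: card_Diff_subset)
  have meets: "\<not> skew W U1" "\<not> skew W U2" "\<not> skew W U3" if W: "W \<in> X" for W
  proof -
    have "distinct [U1, U2, U3, W]" using U(4-6) X(2-4)[OF W] by simp
    from fourth_line_meets[OF assms(2) ge6 U(1-3) X(1)[OF W] this U(7-9)]
    show "\<not> skew W U1" "\<not> skew W U2" "\<not> skew W U3" .
  qed
  have skewX: "skew W W'" if W: "W \<in> X" "W' \<in> X" "W \<noteq> W'" for W W'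
  proof (rule ccontr)
    assume "\<not> skew W W'"
    then show False
      using no_three_pairwise_meeting[OF assms(2) X(1)[OF W(1)] X(1)[OF W(2)] U(1) W(3)
          X(2)[OF W(1)] X(2)[OF W(2)] _ meets(1)[OF W(1)] meets(1)[OF W(2)]] by simp
  qed
  have "card X \<le> 3"
  proof (rule ccontr)
    assume "\<not> ?thesis"
    then have X4: "card X \<ge> 4" by simp
    then have "card X \<ge> 3" by simp
    then obtain Y where Y: "Y \<subseteq> X" "card Y = 3" by (metis obtain_subset_with_card_n)
    then obtain W1 W2 W3 where W: "Y = {W1, W2, W3}" "W1 \<noteq> W2" "W2 \<noteq> W3" "W1 \<noteq> W3"
      by (auto simp: card_3_iff)
    \<comment> \<open>Now \<open>Y\<close> takes over the part of the three skew lines, so \<open>W4\<close> must meet its members.\<close>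
    have "card X \<noteq> card Y" using Y(2) X4 by simp
    then obtain W4 where W4: "W4 \<in> X" "W4 \<notin> Y" using Y(1) by (metis subsetI subset_antisym)
    have WX: "W1 \<in> X" "W2 \<in> X" "W3 \<in> X" using Y(1) W(1) by simp_all
    have "distinct [W1, W2, W3, W4]" using W W4(2) by (simp, metis)
    then have "\<not> skew W4 W1"
      by (rule fourth_line_meets(1)[OF assms(2) ge6 X(1)[OF WX(1)] X(1)[OF WX(2)] X(1)[OF WX(3)]
          X(1)[OF W4(1)] _ skewX[OF WX(1,2) W(2)] skewX[OF WX(1,3) W(4)] skewX[OF WX(2,3) W(3)]])
    moreover have "W4 \<noteq> W1" using W(1) W4(2) by blast
    ultimately show False using skewX[OF W4(1) WX(1)] by simp
  qed
  then have le6: "card \<S> \<le> 6" using cardX by simp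
  with cardX ge6 have "card X = 3" by simp
  then obtain W1 W2 W3 where W: "X = {W1, W2, W3}" "W1 \<noteq> W2" "W2 \<noteq> W3" "W1 \<noteq> W3"
    by (auto simp: card_3_iff)
  then have WX: "W1 \<in> X" "W2 \<in> X" "W3 \<in> X" by simp_all
  note WS = WX[THEN X(1)]
  have "\<S> = {U1, U2, U3} \<union> X" unfolding X_def using U(1-3) by blast
  then have S: "\<S> = {U1, U2, U3, W1, W2, W3}" by (simp only: W(1) Un_insert_left Un_empty_left)
  note skews = skewX[OF WX(1,2) W(2)] skewX[OF WX(1,3) W(4)] skewX[OF WX(2,3) W(3)]
  obtain e1 e2 e3 e4 where ind: "indep4 e1 e3 e2 e4"
    and U1: "U1 = vec.span {e1, e3}" and U2: "U2 = vec.span {e2, e4}"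
    and U3: "U3 = vec.span {e1 + e2, e3 + e4}" and W1: "W1 = vec.span {e1, e2}"
    and W2: "W2 = vec.span {e3, e4}" and W3: "W3 = vec.span {e1 + e3, e2 + e4}"
    by (rule grid_frame[OF line[OF U(1)] line[OF U(2)] line[OF U(3)] U(7-9)
        line[OF WS(1)] line[OF WS(2)] line[OF WS(3)] skews meets[OF WX(1)] meets[OF WX(2)] meets[OF WX(3)]])
  have "q \<ge> 3"
  proof (rule ccontr)
    assume "\<not> q \<ge> 3"
    \<comment> \<open>With only one nonzero scalar, a fixed point of projective space is a fixed vector. So the matrix
      that moves \<open>W3\<close> fixes \<open>e1\<close> and \<open>e3\<close>, and with them the vector \<open>e1 + e3\<close> of \<open>W3\<close>.\<close>
    then have small: "CARD('a) < 3" using assms(1) by simp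
    obtain A where A: "invertible A" "\<And>x. x \<in> W3 \<Longrightarrow> A *v x \<in> W3 \<Longrightarrow> x = 0"
      "\<And>T. T \<in> \<S> \<Longrightarrow> T \<noteq> W3 \<Longrightarrow> stabilizes A T"
      using msr_mover[OF assms(2) WS(3)] by metis
    have fixed: "A *v x = x" if x: "x \<in> U1" "x \<in> W" "x \<noteq> 0" and W: "W \<in> X" "W \<noteq> W3" for x W
    proof -
      have "stabilizes A U1" "stabilizes A W"
        by (rule A(3)[OF U(1) X(2)[OF WX(3), symmetric]], rule A(3)[OF X(1)[OF W(1)] W(2)])
      then have "A *v x \<in> U1" "A *v x \<in> W" using x by blast+
      then obtain c where c: "A *v x = c *s x"
        using meet_multiple[OF line[OF U(1)] line[OF X(1)[OF W(1)]] X(2)[OF W(1), symmetric] x] by blast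
      then have "c \<noteq> 0" using x(3) invertible_mult_eq_0[OF A(1), of x] by auto
      then have "c = 1" by (rule nonzero_eq_1_of_card_less_3[OF small])
      then show ?thesis using c by simp
    qed
    have nonzero: "e1 \<noteq> 0" "e3 \<noteq> 0" "e1 + e3 \<noteq> 0"
      using indep4_coefficients[OF ind, of 1 0 0 0 0 0 0 0] indep4_coefficients[OF ind, of 0 1 0 0 0 0 0 0]
        indep4_coefficients[OF ind, of 1 1 0 0 0 0 0 0] by auto
    have "e1 \<in> U1" "e1 \<in> W1" "e3 \<in> U1" "e3 \<in> W2"
      unfolding U1 W1 W2 by (auto intro: vec.span_base)
    then have "A *v e1 = e1" "A *v e3 = e3"
      using fixed[OF _ _ nonzero(1) WX(1) W(4)] fixed[OF _ _ nonzero(2) WX(2) W(3)] by simp_all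
    then have "A *v (e1 + e3) = e1 + e3" by (simp add: matrix_vector_right_distrib)
    moreover have "e1 + e3 \<in> W3" unfolding W3 by (auto intro: vec.span_base)
    ultimately show False using A(2) nonzero(3) by auto
  qed
  moreover have "isomorphic_families \<S> six_subspaces"
    unfolding S unfolding U1 U2 U3 W1 W2 W3 by (rule frame_isomorphic_six_subspaces[OF ind])
  ultimately show ?thesis using le6 by blast
qed

end
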